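(* Let $F:\mathcal{S}_n\to\mathbb{R}$ be uniformly elliptic, continuous and quasiconcave, and let $u,v\in C(B_1)$ be viscosity subsolutions of $F(D^2w)=0$ in $B_1\subset\mathbb{R}^n$. Then for every $\theta\in(0,1)$ the function $w=\theta u+(1-\theta)v$ is a viscosity subsolution of $F(D^2w)=0$ in $B_1$.
   Context: $\mathcal{S}_n$ is the space of real symmetric $n\times n$ matrices. $F$ is uniformly elliptic with constants $0<\lambda\le\Lambda$ if $\lambda\|N\|\leq F(M+N)-F(M)\leq\Lambda\|N\|$ for all $M,N\in\mathcal{S}_n$ with $N\geq0$, where $\|N\|=\sup_{|x|=1}|Nx|$. $F$ is quasiconcave if $F(\theta M_1+(1-\theta)M_2)\geq\min\{F(M_1),F(M_2)\}$ for all $M_1,M_2\in\mathcal{S}_n$, $\theta\in[0,1]$. A continuous $u$ is a viscosity subsolution of $F(D^2u)=0$ in $\Omega$ if whenever $\varphi\in C^2(\Omega)$ and $u-\varphi$ has a local maximum at $x_0\in\Omega$, then $F(D^2\varphi(x_0))\geq0$. *)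

theory Defs
  imports "HOL-Analysis.Analysis"
begin

definition sym_mat :: "real^'n^'n \<Rightarrow> bool" where
  "sym_mat M \<longleftrightarrow> transpose M = M"

definition psd_mat :: "real^'n^'n \<Rightarrow> bool" where
  "psd_mat N \<longleftrightarrow> (\<forall>x::real^'n. 0 \<le> x \<bullet> (N *v x))"

definition mat_norm :: "real^'n^'n \<Rightarrow> real" where
  "mat_norm N = onorm (\<lambda>x::real^'n. N *v x)"

definition unif_elliptic :: "(real^'n^'n \<Rightarrow> real) \<Rightarrow> real \<Rightarrow> real \<Rightarrow> bool" where
  "unif_elliptic F lam Lam \<longleftrightarrow> 0 < lam \<and> lam \<le> Lam \<and>
     (\<forall>M N. sym_mat M \<longrightarrow> sym_mat N \<longrightarrow> psd_mat N \<longrightarrow>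
        lam * mat_norm N \<le> F (M + N) - F M \<and> F (M + N) - F M \<le> Lam * mat_norm N)"

definition quasiconcave :: "(real^'n^'n \<Rightarrow> real) \<Rightarrow> bool" where
  "quasiconcave F \<longleftrightarrow> (\<forall>M1 M2 t. sym_mat M1 \<longrightarrow> sym_mat M2 \<longrightarrow> 0 \<le> t \<longrightarrow> t \<le> 1 \<longrightarrow>
      F (t *\<^sub>R M1 + (1 - t) *\<^sub>R M2) \<ge> min (F M1) (F M2))"

definition C2_with :: "(real^'n \<Rightarrow> real) \<Rightarrow> (real^'n \<Rightarrow> real^'n) \<Rightarrow> (real^'n \<Rightarrow> real^'n^'n)
   \<Rightarrow> (real^'n) set \<Rightarrow> bool" where
  "C2_with phi Dphi H \<Omega> \<longleftrightarrow>
     (\<forall>x\<in>\<Omega>. (phi has_derivative (\<lambda>h. Dphi x \<bullet> h)) (at x)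
            \<and> (Dphi has_derivative (\<lambda>h. H x *v h)) (at x))
     \<and> continuous_on \<Omega> H"

definition local_max_on :: "(real^'n \<Rightarrow> real) \<Rightarrow> (real^'n) set \<Rightarrow> real^'n \<Rightarrow> bool" where
  "local_max_on f \<Omega> x0 \<longleftrightarrow> (\<exists>e>0. \<forall>y\<in>\<Omega> \<inter> ball x0 e. f y \<le> f x0)"

definition visc_subsol :: "(real^'n^'n \<Rightarrow> real) \<Rightarrow> (real^'n \<Rightarrow> real) \<Rightarrow> (real^'n) set \<Rightarrow> bool" where
  "visc_subsol F u \<Omega> \<longleftrightarrow> continuous_on \<Omega> u \<and>
     (\<forall>phi Dphi H x0. C2_with phi Dphi H \<Omega> \<longrightarrow> x0 \<in> \<Omega> \<longrightarrow>
        local_max_on (\<lambda>x. u x - phi x) \<Omega> x0 \<longrightarrow> F (H x0) \<ge> 0)"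

end

theory Submission
  imports Defs "HOL-Library.Function_Algebras"
begin

text \<open>
  The set \<open>K\<close> of symmetric matrices with \<open>F \<ge> 0\<close> is closed and convex. If a test function touching
  \<open>w\<close> from above had its Hessian outside \<open>K\<close>, a hyperplane \<open>A \<bullet> M = c\<close> would separate this Hessian
  strictly from \<open>K\<close>, and uniform ellipticity makes \<open>A\<close> positive on nonzero positive semidefinite
  matrices. Both \<open>u\<close> and \<open>v\<close> are then subsolutions of the linear equation \<open>A \<bullet> D\<^sup>2w = c\<close>, so it
  suffices to treat linear equations with constant coefficients, and no regularity theory
  for semiconvex functions is needed.

  In the linear case \<open>v\<close> is replaced, on a small ball, by a smooth majorant \<open>h\<close> that solves the
  equation and is close to \<open>v\<close> on the sphere; the test function for \<open>w\<close> then yields a test function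
  for \<open>u\<close>. The majorant is a polynomial: by Stone-Weierstrass it is enough to solve the Dirichlet
  problem with polynomial boundary data, and this is possible since
  \<open>q \<mapsto> A \<bullet> D\<^sup>2((r\<^sup>2 - |x - z|\<^sup>2) q)\<close> maps the finite-dimensional space of polynomials of degree at
  most \<open>k\<close> to itself and is injective by the maximum principle.
\<close>

section \<open>Second-order calculus\<close>

lemma C2_withD:
  assumes "C2_with f D H \<Omega>" "x \<in> \<Omega>"
  shows "(f has_derivative (\<lambda>h. D x \<bullet> h)) (at x)" "(D has_derivative (\<lambda>h. H x *v h)) (at x)"
  using assms by (auto simp: C2_with_def)

section \<open>Differentiation along lines and second differences\<close>

lemma C2_with_line:
  assumes C: "C2_with f D H \<Omega>" and x: "x + t *\<^sub>R e \<in> \<Omega>"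
  shows "((\<lambda>t. f (x + t *\<^sub>R e)) has_real_derivative D (x + t *\<^sub>R e) \<bullet> e) (at t)"
    and "((\<lambda>t. D (x + t *\<^sub>R e) \<bullet> b) has_real_derivative (H (x + t *\<^sub>R e) *v e) \<bullet> b) (at t)"
proof -
  have l: "((\<lambda>t. x + t *\<^sub>R e) has_derivative (\<lambda>s. s *\<^sub>R e)) (at t)"
    by (auto intro!: derivative_eq_intros)
  show "((\<lambda>t. f (x + t *\<^sub>R e)) has_real_derivative D (x + t *\<^sub>R e) \<bullet> e) (at t)"
    using diff_chain_at[OF l C2_withD(1)[OF C x]] unfolding o_def
    by (rule has_derivative_imp_has_field_derivative) simp
  show "((\<lambda>t. D (x + t *\<^sub>R e) \<bullet> b) has_real_derivative (H (x + t *\<^sub>R e) *v e) \<bullet> b) (at t)"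
    using has_derivative_inner_left[OF diff_chain_at[OF l C2_withD(2)[OF C x]], of b] unfolding o_def
    by (rule has_derivative_imp_has_field_derivative) (simp add: matrix_vector_mult_scaleR)
qed

text \<open>One mean value step in direction \<open>a\<close> turns the second difference into a
  difference of two values of \<open>D\<close>, and differentiability of \<open>D\<close> at
  \<open>x\<close> alone controls that difference. The left-hand expression is symmetric in
  \<open>a\<close> and \<open>b\<close>, which is what yields symmetry of the Hessian.\<close>

lemma C2_with_second_difference:
  fixes x a b :: "real^'n"
  assumes C: "C2_with f D H \<Omega>" and "open \<Omega>" "x \<in> \<Omega>" and "0 < \<epsilon>"
  shows "eventually (\<lambda>t. \<bar>f (x + t *\<^sub>R a + t *\<^sub>R b) - f (x + t *\<^sub>R a) - f (x + t *\<^sub>R b) + f x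
            - t\<^sup>2 * ((H x *v b) \<bullet> a)\<bar> \<le> \<epsilon> * t\<^sup>2) (at_right 0)"
proof -
  \<comment> \<open>\<open>K\<close> absorbs the factors in the final estimate, where the two
    remainders of \<open>D\<close> are paired with \<open>a\<close>; the summands \<open>1\<close>
    keep it positive when \<open>a\<close> and \<open>b\<close> vanish.\<close>
  define K where "K = (2 * norm a + norm b + 1) * (norm a + 1)"
  have K: "K > 0" unfolding K_def by (intro mult_pos_pos) (auto intro: add_nonneg_pos)
  obtain r where r: "0 < r" "ball x r \<subseteq> \<Omega>"
    using assms openE by blast
  obtain d where d: "0 < d" "\<And>y. norm (y - x) < d \<Longrightarrow>
       norm (D y - D x - H x *v (y - x)) \<le> \<epsilon> / K * norm (y - x)"
    using C2_withD(2)[OF C \<open>x \<in> \<Omega>\<close>] \<open>0 < \<epsilon>\<close> K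
    unfolding has_derivative_at_alt by (meson divide_pos_pos)
  \<comment> \<open>For \<open>t < m\<close> every \<open>x + s *\<^sub>R a + s' *\<^sub>R b\<close>
    with \<open>s\<close>, \<open>s'\<close> between \<open>0\<close> and \<open>t\<close> stays in
    the domain and in the range where the expansion of \<open>D\<close> is valid.\<close>
  define m where "m = min r d / (norm a + norm b + 1)"
  have np: "norm a + norm b + 1 > 0" by (auto intro: add_nonneg_pos)
  have m: "0 < m" using r d np by (simp add: m_def)
  have "\<bar>f (x + t *\<^sub>R a + t *\<^sub>R b) - f (x + t *\<^sub>R a) - f (x + t *\<^sub>R b) + f x
            - t\<^sup>2 * ((H x *v b) \<bullet> a)\<bar> \<le> \<epsilon> * t\<^sup>2" if t: "0 < t" "t < m" for t
  proof -
    have near: "norm (s *\<^sub>R a + s' *\<^sub>R b) < min r d" if "0 \<le> s" "s \<le> t" "0 \<le> s'" "s' \<le> t" for s s'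
    proof -
      have "norm (s *\<^sub>R a + s' *\<^sub>R b) \<le> s * norm a + s' * norm b"
        using norm_triangle_ineq[of "s *\<^sub>R a" "s' *\<^sub>R b"] that by simp
      also have "\<dots> \<le> t * norm a + t * norm b"
        using that by (intro add_mono mult_right_mono) auto
      also have "\<dots> \<le> t * (norm a + norm b + 1)" using t by (simp add: algebra_simps)
      also have "\<dots> < min r d" using t np by (simp add: m_def field_simps)
      finally show ?thesis .
    qed
    have inO: "x + s *\<^sub>R a + s' *\<^sub>R b \<in> \<Omega>" if "0 \<le> s" "s \<le> t" "0 \<le> s'" "s' \<le> t" for s s'
      using near[OF that] r by (auto simp: dist_norm norm_minus_commute algebra_simps subset_iff)
    define g where "g s = f ((x + t *\<^sub>R b) + s *\<^sub>R a) - f (x + s *\<^sub>R a)" for s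
    have dg: "(g has_real_derivative D ((x + t *\<^sub>R b) + s *\<^sub>R a) \<bullet> a - D (x + s *\<^sub>R a) \<bullet> a) (at s)"
      if "0 \<le> s" "s \<le> t" for s
      unfolding g_def
      by (intro DERIV_diff C2_with_line(1)[OF C])
        (use inO[of s t] inO[of s 0] that t in \<open>simp_all add: algebra_simps\<close>)
    obtain s where s: "0 < s" "s < t"
      "g t - g 0 = (t - 0) * (D ((x + t *\<^sub>R b) + s *\<^sub>R a) \<bullet> a - D (x + s *\<^sub>R a) \<bullet> a)"
      using MVT2[OF t(1), of g "\<lambda>s. D ((x + t *\<^sub>R b) + s *\<^sub>R a) \<bullet> a - D (x + s *\<^sub>R a) \<bullet> a"] dg
      by blast
    \<comment> \<open>\<open>e1\<close> and \<open>e2\<close> are the remainders of \<open>D\<close>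
      at the two points. In their difference the terms with the unknown intermediate
      \<open>s\<close> cancel, leaving only \<open>t *\<^sub>R (H x *v b)\<close>.\<close>
    define e1 where "e1 = D ((x + t *\<^sub>R b) + s *\<^sub>R a) - D x - H x *v (t *\<^sub>R b + s *\<^sub>R a)"
    define e2 where "e2 = D (x + s *\<^sub>R a) - D x - H x *v (s *\<^sub>R a)"
    have b1: "norm e1 \<le> \<epsilon> / K * (t * (norm a + norm b))"
    proof -
      have "norm e1 \<le> \<epsilon> / K * norm (t *\<^sub>R b + s *\<^sub>R a)"
        using d(2)[of "(x + t *\<^sub>R b) + s *\<^sub>R a"] near[of s t] s t
        by (simp add: e1_def algebra_simps)
      moreover have "norm (t *\<^sub>R b + s *\<^sub>R a) \<le> t * norm b + s * norm a"
        using norm_triangle_ineq[of "t *\<^sub>R b" "s *\<^sub>R a"] s t by simp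
      moreover have "t * norm b + s * norm a \<le> t * (norm a + norm b)"
        using s by (simp add: distrib_left mult_right_mono)
      ultimately show ?thesis using \<open>0 < \<epsilon>\<close> K
        by (meson divide_nonneg_pos less_imp_le mult_left_mono order_trans)
    qed
    have b2: "norm e2 \<le> \<epsilon> / K * (t * norm a)"
    proof -
      have "norm e2 \<le> \<epsilon> / K * norm (s *\<^sub>R a)"
        using d(2)[of "x + s *\<^sub>R a"] near[of s 0] s t by (simp add: e2_def)
      moreover have "norm (s *\<^sub>R a) \<le> t * norm a" using s by (simp add: mult_right_mono)
      ultimately show ?thesis using \<open>0 < \<epsilon>\<close> K
        by (meson divide_nonneg_pos less_imp_le mult_left_mono order_trans)
    qed
    have "f (x + t *\<^sub>R a + t *\<^sub>R b) - f (x + t *\<^sub>R a) - f (x + t *\<^sub>R b) + f x = g t - g 0"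
      by (simp add: g_def algebra_simps)
    also have "\<dots> = t * ((e1 - e2 + t *\<^sub>R (H x *v b)) \<bullet> a)"
      by (simp add: s(3) e1_def e2_def matrix_vector_right_distrib matrix_vector_mult_scaleR
          inner_diff_left inner_add_left algebra_simps)
    also have "\<dots> - t\<^sup>2 * ((H x *v b) \<bullet> a) = t * ((e1 - e2) \<bullet> a)"
      by (simp add: inner_add_left power2_eq_square algebra_simps)
    finally have eq: "f (x + t *\<^sub>R a + t *\<^sub>R b) - f (x + t *\<^sub>R a) - f (x + t *\<^sub>R b) + f x
            - t\<^sup>2 * ((H x *v b) \<bullet> a) = t * ((e1 - e2) \<bullet> a)" .
    have "\<bar>(e1 - e2) \<bullet> a\<bar> \<le> (norm e1 + norm e2) * norm a"
      by (rule order_trans[OF Cauchy_Schwarz_ineq2]) (intro mult_right_mono norm_triangle_ineq4, simp)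
    also have "\<dots> \<le> (\<epsilon> / K * (t * (2 * norm a + norm b))) * norm a"
      using add_mono[OF b1 b2] by (intro mult_right_mono) (simp_all add: algebra_simps)
    also have "\<dots> \<le> (\<epsilon> / K * (t * (2 * norm a + norm b + 1))) * (norm a + 1)"
      using \<open>0 < \<epsilon>\<close> K t by (intro mult_mono mult_left_mono) auto
    also have "\<dots> = \<epsilon> / K * t * K" by (simp add: K_def algebra_simps)
    also have "\<dots> = \<epsilon> * t" using K by simp
    finally show ?thesis
      unfolding eq using t by (simp add: abs_mult power2_eq_square mult.left_commute)
  qed
  then show ?thesis
    using m unfolding eventually_at_right_field by blast
qed

lemma sym_matI:
  fixes M :: "real^'n^'n"
  assumes "\<And>a b. (M *v b) \<bullet> a = (M *v a) \<bullet> b"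
  shows "sym_mat M"
proof -
  have "M $ i $ j = M $ j $ i" for i j
    using assms[of "axis j 1" "axis i 1"]
    by (simp add: inner_axis matrix_vector_mul_component)
  then show ?thesis
    by (simp add: sym_mat_def transpose_def vec_eq_iff)
qed

text \<open>Exchanging \<open>a\<close> and \<open>b\<close> does not change the second difference,
  so both values of the bilinear form are its limit after division by \<open>t\<^sup>2\<close>. The
  hypotheses on \<open>F\<close> concern symmetric matrices only, so test Hessians must be known to
  be symmetric.\<close>

lemma C2_with_sym:
  fixes f :: "real^'n \<Rightarrow> real"
  assumes C: "C2_with f D H \<Omega>" and "open \<Omega>" "x \<in> \<Omega>"
  shows "sym_mat (H x)"
proof (rule sym_matI)
  fix a b :: "real^'n"
  have "\<bar>(H x *v b) \<bullet> a - (H x *v a) \<bullet> b\<bar> \<le> e" if "e > 0" for e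
  proof -
    have "\<exists>t>0::real. \<bar>(H x *v b) \<bullet> a - (H x *v a) \<bullet> b\<bar> * t\<^sup>2 \<le> e * t\<^sup>2"
    proof -
      have "eventually (\<lambda>t. \<bar>(H x *v b) \<bullet> a - (H x *v a) \<bullet> b\<bar> * t\<^sup>2 \<le> e * t\<^sup>2) (at_right (0::real))"
        using C2_with_second_difference[OF assms half_gt_zero[OF that], of a b]
          C2_with_second_difference[OF assms half_gt_zero[OF that], of b a]
      proof eventually_elim
        case (elim t)
        have "\<bar>t\<^sup>2 * ((H x *v b) \<bullet> a) - t\<^sup>2 * ((H x *v a) \<bullet> b)\<bar> \<le> e * t\<^sup>2"
          using elim unfolding add.assoc add.commute[of "t *\<^sub>R a" "t *\<^sub>R b"] abs_le_iff
          by argo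
        also have "t\<^sup>2 * ((H x *v b) \<bullet> a) - t\<^sup>2 * ((H x *v a) \<bullet> b)
            = ((H x *v b) \<bullet> a - (H x *v a) \<bullet> b) * t\<^sup>2" by (simp add: algebra_simps)
        finally show ?case by (simp add: abs_mult)
      qed
      then obtain m where "m > 0"
        "\<And>t. 0 < t \<Longrightarrow> t < m \<Longrightarrow> \<bar>(H x *v b) \<bullet> a - (H x *v a) \<bullet> b\<bar> * t\<^sup>2 \<le> e * t\<^sup>2"
        unfolding eventually_at_right_field by auto
      then show ?thesis by (meson dense)
    qed
    then show ?thesis by auto
  qed
  then show "(H x *v b) \<bullet> a = (H x *v a) \<bullet> b"
    using field_le_epsilon[of "\<bar>(H x *v b) \<bullet> a - (H x *v a) \<bullet> b\<bar>" 0] by simp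
qed

section \<open>Second-order condition at a local maximum\<close>

lemma uminus_matrix_vector_mult: "(- M) *v x = - (M *v (x::real^'n))"
  by (simp add: matrix_vector_mult_def vec_eq_iff sum_negf)

text \<open>If the Hessian were positive in a direction \<open>e\<close>, the slope along
  \<open>e\<close>, which vanishes at the maximum, would be positive just to the right of it, and
  \<open>f\<close> would increase there.\<close>

lemma C2_with_local_max_psd:
  fixes f :: "real^'n \<Rightarrow> real"
  assumes C: "C2_with f D H \<Omega>" and "open \<Omega>" "x \<in> \<Omega>" and max: "local_max_on f \<Omega> x"
  shows "psd_mat (- H x)"
  unfolding psd_mat_def
proof (rule allI, rule ccontr)
  fix e assume "\<not> 0 \<le> e \<bullet> (- H x *v e)"
  then have pos: "(H x *v e) \<bullet> e > 0"
    by (simp add: uminus_matrix_vector_mult inner_commute)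
  obtain r0 where r0: "r0 > 0" "\<And>y. y \<in> \<Omega> \<inter> ball x r0 \<Longrightarrow> f y \<le> f x"
    using max by (auto simp: local_max_on_def)
  obtain r1 where r1: "0 < r1" "ball x r1 \<subseteq> \<Omega>" using assms openE by blast
  define r where "r = min r0 r1 / (norm e + 1)"
  have ne: "norm e + 1 > 0" by (auto intro: add_nonneg_pos)
  have r: "r > 0" using r0 r1 ne by (simp add: r_def)
  have inb: "x + t *\<^sub>R e \<in> \<Omega> \<inter> ball x r0" if "\<bar>t\<bar> < r" for t
  proof -
    have "\<bar>t\<bar> * norm e \<le> \<bar>t\<bar> * (norm e + 1)" by (simp add: mult_left_mono)
    also have "\<dots> < min r0 r1" using that ne by (simp add: r_def field_simps)
    finally show ?thesis using r1 by (auto simp: dist_norm subset_iff)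
  qed
  define g where "g t = f (x + t *\<^sub>R e)" for t
  have dg: "(g has_real_derivative D (x + t *\<^sub>R e) \<bullet> e) (at t)" if "\<bar>t\<bar> < r" for t
    unfolding g_def using C2_with_line(1)[OF C] inb[OF that] by blast
  have z: "D x \<bullet> e = 0"
  proof -
    have "D (x + 0 *\<^sub>R e) \<bullet> e = 0"
      by (rule DERIV_local_max[OF dg r])
         (use r inb r0(2) in \<open>auto simp: g_def\<close>)
    then show ?thesis by simp
  qed
  have "((\<lambda>t. D (x + t *\<^sub>R e) \<bullet> e) has_real_derivative (H x *v e) \<bullet> e) (at 0)"
    using C2_with_line(2)[OF C, of x 0 e e] assms(3) by simp
  from has_real_derivative_pos_inc_right[OF this pos]
  obtain d where d: "d > 0" "\<And>t. 0 < t \<Longrightarrow> t < d \<Longrightarrow> 0 < D (x + t *\<^sub>R e) \<bullet> e"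
    using z by auto
  define t where "t = min d r / 2"
  have t: "0 < t" "t < d" "t < r" using d r by (auto simp: t_def min_def)
  obtain s where s: "0 < s" "s < t" "g t - g 0 = (t - 0) * (D (x + s *\<^sub>R e) \<bullet> e)"
    using MVT2[OF t(1), of g "\<lambda>t. D (x + t *\<^sub>R e) \<bullet> e"] dg t by auto
  have "g t > g 0" using s d(2)[of s] t by (smt (verit) mult_pos_pos)
  moreover have "g t \<le> g 0" using r0(2)[OF inb[of t]] t by (simp add: g_def)
  ultimately show False by simp
qed

section \<open>Linear combinations and the squared distance\<close>

lemma C2_with_lincomb:
  assumes f: "C2_with f D H \<Omega>" and g: "C2_with g E G \<Omega>"
  shows "C2_with (\<lambda>x. a * f x + b * g x) (\<lambda>x. a *\<^sub>R D x + b *\<^sub>R E x)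
           (\<lambda>x. a *\<^sub>R H x + b *\<^sub>R G x) \<Omega>"
  unfolding C2_with_def
proof (intro conjI ballI)
  fix x assume x: "x \<in> \<Omega>"
  show "((\<lambda>x. a * f x + b * g x) has_derivative (\<lambda>h. (a *\<^sub>R D x + b *\<^sub>R E x) \<bullet> h)) (at x)"
    by (rule derivative_eq_intros C2_withD(1)[OF f x] C2_withD(1)[OF g x] refl)+
       (simp add: inner_add_left)
  show "((\<lambda>x. a *\<^sub>R D x + b *\<^sub>R E x) has_derivative (\<lambda>h. (a *\<^sub>R H x + b *\<^sub>R G x) *v h)) (at x)"
    by (rule derivative_eq_intros C2_withD(2)[OF f x] C2_withD(2)[OF g x] refl)+
       (simp add: matrix_vector_mult_add_rdistrib scaleR_matrix_vector_assoc)
next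
  show "continuous_on \<Omega> (\<lambda>x. a *\<^sub>R H x + b *\<^sub>R G x)"
    using f g by (auto simp: C2_with_def intro!: continuous_intros)
qed

lemma C2_with_square_norm:
  "C2_with (\<lambda>x. (x - z) \<bullet> (x - z)) (\<lambda>x. 2 *\<^sub>R (x - z)) (\<lambda>x. 2 *\<^sub>R mat 1) \<Omega>"
  unfolding C2_with_def
proof (intro conjI ballI)
  fix x
  show "((\<lambda>x. (x - z) \<bullet> (x - z)) has_derivative (\<lambda>h. 2 *\<^sub>R (x - z) \<bullet> h)) (at x)"
    by (rule derivative_eq_intros refl)+ (simp add: inner_commute)
  show "((\<lambda>x. 2 *\<^sub>R (x - z)) has_derivative (\<lambda>h. (2 *\<^sub>R mat 1) *v h)) (at x)"
    by (rule derivative_eq_intros refl)+ (simp add: scaleR_matrix_vector_assoc[symmetric])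
qed simp

lemma C2_with_continuous_on:
  assumes "C2_with f D H \<Omega>"
  shows "continuous_on \<Omega> f"
  using C2_withD(1)[OF assms]
  by (meson continuous_at_imp_continuous_on has_derivative_continuous)

section \<open>Comparison for linear equations\<close>

text \<open>\<open>A \<bullet> N\<close> is the Frobenius product, so this says that the symmetric
  part of \<open>A\<close> is positive definite. Testing against positive semidefinite matrices is
  the form in which the property comes out of the separation argument.\<close>

definition elliptic_mat :: "real^'n^'n \<Rightarrow> bool" where
  "elliptic_mat A \<longleftrightarrow> (\<forall>N. sym_mat N \<longrightarrow> psd_mat N \<longrightarrow> N \<noteq> 0 \<longrightarrow> 0 < A \<bullet> N)"

lemma psd_mat_1: "psd_mat (mat 1)"
  by (simp add: psd_mat_def)

lemma sym_mat_1: "sym_mat (mat 1)"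
  by (simp add: sym_mat_def transpose_mat)

lemma mat_1_nonzero: "(mat 1 :: real^'n^'n) \<noteq> 0"
  by (metis matrix_vector_mul_lid matrix_vector_mult_0 axis_eq_0_iff zero_neq_one)

lemma elliptic_mat_1:
  assumes "elliptic_mat A" shows "0 < A \<bullet> mat 1"
  using assms psd_mat_1 sym_mat_1 mat_1_nonzero by (auto simp: elliptic_mat_def)

lemma visc_subsolD:
  assumes "visc_subsol F u \<Omega>" "C2_with phi D H \<Omega>" "x \<in> \<Omega>" "local_max_on (\<lambda>x. u x - phi x) \<Omega> x"
  shows "0 \<le> F (H x)"
  using assms unfolding visc_subsol_def by blast

lemma local_max_on_ball:
  assumes "x \<in> ball z r" and "\<And>y. y \<in> cball z r \<Longrightarrow> f y \<le> f x"
  shows "local_max_on f \<Omega> x"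
proof -
  obtain e where "e > 0" "ball x e \<subseteq> ball z r"
    using assms(1) openE by blast
  then show ?thesis
    using assms(2) unfolding local_max_on_def by (intro exI[of _ e]) force
qed

text \<open>Where \<open>f - phi\<close> has a local maximum, \<open>G x - H x\<close> is positive
  semidefinite, and \<open>A\<close> pairs nonnegatively with it. This makes polynomials accessible
  to the comparison principle.\<close>

lemma visc_subsol_classical:
  assumes A: "elliptic_mat A" and \<Omega>: "open \<Omega>" and C: "C2_with f D H \<Omega>"
    and L: "\<And>x. x \<in> \<Omega> \<Longrightarrow> c \<le> A \<bullet> H x"
  shows "visc_subsol (\<lambda>M. A \<bullet> M - c) f \<Omega>"
  unfolding visc_subsol_def
proof (intro conjI allI impI)
  show "continuous_on \<Omega> f" using C by (rule C2_with_continuous_on)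
next
  fix phi E G x
  assume phi: "C2_with phi E G \<Omega>" and x: "x \<in> \<Omega>" and max: "local_max_on (\<lambda>x. f x - phi x) \<Omega> x"
  have C2: "C2_with (\<lambda>x. f x - phi x) (\<lambda>x. D x - E x) (\<lambda>x. H x - G x) \<Omega>"
    using C2_with_lincomb[OF C phi, of 1 "-1"] by simp
  have "psd_mat (- (H x - G x))"
    using C2_with_local_max_psd[OF C2 \<Omega> x max] .
  moreover have "sym_mat (G x - H x)"
    using C2_with_sym[OF C \<Omega> x] C2_with_sym[OF phi \<Omega> x] by (simp add: sym_mat_def transpose_def vec_eq_iff)
  ultimately have "0 \<le> A \<bullet> (G x - H x)"
    using A unfolding elliptic_mat_def by (cases "G x - H x = 0") (auto intro: less_imp_le)
  then show "0 \<le> A \<bullet> G x - c"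
    using L[OF x] by (simp add: inner_diff_right)
qed

text \<open>Subtracting a small multiple of |x - z|^2 makes \<open>h\<close> a strict supersolution.
  Being smooth, it is itself a test function, so \<open>g - \<psi>\<close> cannot have its maximum
  inside the ball; on the sphere the perturbation costs at most
  \<open>\<epsilon> * r\<^sup>2\<close>.\<close>

lemma visc_subsol_comparison:
  assumes A: "elliptic_mat A" and g: "visc_subsol (\<lambda>M. A \<bullet> M - c) g \<Omega>"
    and \<Omega>: "cball z r \<subseteq> \<Omega>" and h: "C2_with h D H \<Omega>"
    and L: "\<And>x. x \<in> \<Omega> \<Longrightarrow> A \<bullet> H x \<le> c"
    and bd: "\<And>x. x \<in> sphere z r \<Longrightarrow> g x \<le> h x" and x: "x \<in> cball z r"
  shows "g x \<le> h x"
proof (rule field_le_epsilon)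
  fix e :: real assume "e > 0"
  have r: "r \<ge> 0" using x by (smt (verit) mem_cball zero_le_dist)
  \<comment> \<open>Chosen so that \<open>\<epsilon> * r\<^sup>2 \<le> e\<close>, with a nonzero
    denominator also for \<open>r = 0\<close>.\<close>
  define \<epsilon> where "\<epsilon> = e / (r\<^sup>2 + 1)"
  have \<epsilon>: "\<epsilon> > 0" using \<open>e > 0\<close> by (simp add: \<epsilon>_def add_nonneg_pos)
  define \<psi> where "\<psi> = (\<lambda>x. h x - \<epsilon> * ((x - z) \<bullet> (x - z)))"
  have \<psi>: "C2_with \<psi> (\<lambda>x. D x - \<epsilon> *\<^sub>R 2 *\<^sub>R (x - z)) (\<lambda>x. H x - \<epsilon> *\<^sub>R 2 *\<^sub>R mat 1) \<Omega>"
    using C2_with_lincomb[OF h C2_with_square_norm[of z], of 1 "-\<epsilon>"] by (simp add: \<psi>_def)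
  have "continuous_on (cball z r) (\<lambda>x. g x - \<psi> x)"
    using g C2_with_continuous_on[OF \<psi>] \<Omega>
    by (auto simp: visc_subsol_def intro!: continuous_on_diff intro: continuous_on_subset)
  then obtain y where y: "y \<in> cball z r" "\<And>x. x \<in> cball z r \<Longrightarrow> g x - \<psi> x \<le> g y - \<psi> y"
    using continuous_attains_sup[OF compact_cball, of z r "\<lambda>x. g x - \<psi> x"] r by auto
  have "y \<notin> ball z r"
  proof
    assume "y \<in> ball z r"
    then have "local_max_on (\<lambda>x. g x - \<psi> x) \<Omega> y" using y(2) by (rule local_max_on_ball)
    from visc_subsolD[OF g \<psi> _ this] have "0 \<le> A \<bullet> (H y - \<epsilon> *\<^sub>R 2 *\<^sub>R mat 1) - c"
      using y(1) \<Omega> by auto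
    moreover have "0 < \<epsilon> * (2 * (A \<bullet> mat 1))" using \<epsilon> elliptic_mat_1[OF A] by simp
    ultimately show False
      using L[of y] y(1) \<Omega> by (auto simp: inner_diff_right)
  qed
  then have "y \<in> sphere z r" using y(1) by (auto simp: sphere_def)
  then have "g y \<le> h y" and ny: "(y - z) \<bullet> (y - z) = r\<^sup>2"
    using bd by (auto simp: dist_norm norm_minus_commute power2_norm_eq_inner[symmetric])
  then have "g y - \<psi> y \<le> \<epsilon> * r\<^sup>2" by (simp add: \<psi>_def)
  moreover have "0 \<le> \<epsilon> * ((x - z) \<bullet> (x - z))" using \<epsilon> by simp
  moreover have "\<epsilon> * r\<^sup>2 \<le> e" using \<open>e > 0\<close> by (simp add: \<epsilon>_def divide_le_eq add_nonneg_pos)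
  ultimately show "g x \<le> h x + e"
    using y(2)[OF x] by (simp add: \<psi>_def)
qed

section \<open>Polynomials in several variables\<close>

lemma (in vector_space) injective_on_span_imp_surjective:
  assumes B: "finite B" and T: "\<And>x. x \<in> span B \<Longrightarrow> T x \<in> span B"
    and add: "\<And>x y. x \<in> span B \<Longrightarrow> y \<in> span B \<Longrightarrow> T (x + y) = T x + T y"
    and scale: "\<And>a x. x \<in> span B \<Longrightarrow> T (scale a x) = scale a (T x)"
    and inj: "\<And>x. x \<in> span B \<Longrightarrow> T x = 0 \<Longrightarrow> x = 0"
    and y: "y \<in> span B"
  obtains x where "x \<in> span B" "T x = y"
proof -
  interpret vector_space_pair scale scale ..
  obtain C where C: "C \<subseteq> B" "independent C" "B \<subseteq> span C"
    using maximal_independent_subset[of B] by blast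
  have sp: "span C = span B"
    using C by (simp add: span_eq span_base subset_iff)
  have fC: "finite C" using C B finite_subset by blast
  define S where "S = construct C T"
  have lin: "Vector_Spaces.linear scale scale S" unfolding S_def using C(2) by (rule linear_construct)
  have ST: "S x = T x" if "x \<in> span B" for x
  proof -
    have "x \<in> span C \<Longrightarrow> x \<in> span C \<and> S x = T x"
    proof (induction rule: span_induct_alt)
      case base
      have "T 0 = 0" using scale[of 0 0] by (simp add: span_zero)
      then show ?case using linear_0[OF lin] by (simp add: span_zero)
    next
      case (step c x y)
      then have "scale c x \<in> span C" "y \<in> span C" "x \<in> span C"
        by (auto intro: span_scale span_base)
      then show ?case
        using step construct_basis[OF C(2), of x T] add[of "scale c x" y] scale[of x c]
        by (auto simp: sp linear_add[OF lin] linear_scale[OF lin] S_def[symmetric] span_add span_base)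
    qed
    then show ?thesis using that sp by simp
  qed
  have injS: "inj_on S (span C)"
    using ST inj sp by (simp add: linear_inj_on_iff_eq_0[OF lin subspace_span])
  have ind: "independent (S ` C)"
    using lin C(2) injS by (rule linear_independent_injective_image)
  have "card (S ` C) = card C"
    using injS by (intro card_image) (meson inj_on_subset span_superset)
  have "y \<in> span (S ` C)"
  proof (rule ccontr)
    assume n: "y \<notin> span (S ` C)"
    have "independent (insert y (S ` C))" using n ind by (rule independent_insertI)
    moreover have "insert y (S ` C) \<subseteq> span C"
      using y ST T sp span_superset[of C] by auto
    ultimately have "card (insert y (S ` C)) \<le> card C"
      using independent_span_bound[OF fC] by blast
    moreover have "y \<notin> S ` C" using n span_base by blast
    ultimately show False using fC \<open>card (S ` C) = card C\<close> by simp
  qed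
  then obtain x where "x \<in> span C" "y = S x"
    using linear_span_image[OF lin] by blast
  then show ?thesis using that ST sp by metis
qed

section \<open>Polynomials of bounded degree as a finite-dimensional space\<close>

interpretation fun_vs: vector_space "\<lambda>c (f :: 'a \<Rightarrow> real) x. c * f x"
  by unfold_locales (auto simp: fun_eq_iff algebra_simps)

text \<open>A list of indices encodes a multi-index through multiplicities. Products become
  concatenation, and the product rule becomes induction on the list.\<close>

definition monomial :: "'n list \<Rightarrow> real^'n \<Rightarrow> real" where
  "monomial xs x = (\<Prod>i\<leftarrow>xs. x $ i)"

definition polys :: "nat \<Rightarrow> (real^'n \<Rightarrow> real) set" where
  "polys k = fun_vs.span (monomial ` {xs. length xs \<le> k})"

lemma finite_monomials: "finite (monomial ` {xs :: 'n::finite list. length xs \<le> k})"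
  using finite_lists_length_le[of "UNIV :: 'n set" k] by simp

lemma polys_monomial: "length xs \<le> k \<Longrightarrow> monomial xs \<in> polys k"
  unfolding polys_def by (rule fun_vs.span_base) simp

lemma polys_induct [consumes 1, case_names zero step]:
  assumes "f \<in> polys k" and "P (\<lambda>x. 0)"
    and "\<And>c xs g. length xs \<le> k \<Longrightarrow> g \<in> polys k \<Longrightarrow> P g \<Longrightarrow> P (\<lambda>x. c * monomial xs x + g x)"
  shows "P f"
proof -
  have "f \<in> polys k \<and> P f"
    using assms(1) unfolding polys_def
  proof (induction rule: fun_vs.span_induct_alt)
    case base
    then show ?case using assms(2) fun_vs.span_zero unfolding zero_fun_def by auto
  next
    case (step c m g)
    then obtain xs where xs: "length xs \<le> k" "m = monomial xs" by auto
    have "(\<lambda>x. c * m x) + g \<in> polys k"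
      using step fun_vs.span_base[OF step(1)] unfolding polys_def
      by (auto intro: fun_vs.span_add fun_vs.span_scale)
    then show ?case
      using step assms(3)[OF xs(1), of g c] xs by (auto simp: polys_def plus_fun_def)
  qed
  then show ?thesis ..
qed

lemma polys_add: "f \<in> polys k \<Longrightarrow> g \<in> polys k \<Longrightarrow> (\<lambda>x. f x + g x) \<in> polys k"
  unfolding polys_def using fun_vs.span_add[of f _ g] by (simp add: plus_fun_def)

lemma polys_cmult: "f \<in> polys k \<Longrightarrow> (\<lambda>x. c * f x) \<in> polys k"
  unfolding polys_def by (rule fun_vs.span_scale)

lemma polys_const: "(\<lambda>x. c) \<in> polys k"
  using polys_cmult[OF polys_monomial[of "[]" k], of c] by (simp add: monomial_def)

lemma polys_diff: "f \<in> polys k \<Longrightarrow> g \<in> polys k \<Longrightarrow> (\<lambda>x. f x - g x) \<in> polys k"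
  using polys_add[of f k "\<lambda>x. -1 * g x"] polys_cmult[of g k "-1"] by simp

lemma polys_sum: "(\<And>i. i \<in> I \<Longrightarrow> f i \<in> polys k) \<Longrightarrow> (\<lambda>x. \<Sum>i\<in>I. f i x) \<in> polys k"
  by (induction I rule: infinite_finite_induct) (auto intro: polys_add polys_const)

lemma polys_mono: "j \<le> k \<Longrightarrow> polys j \<subseteq> polys k"
  unfolding polys_def by (intro fun_vs.span_mono) auto

lemma polys_mult:
  assumes "f \<in> polys j" "g \<in> polys k"
  shows "(\<lambda>x. f x * g x) \<in> polys (j + k)"
  using assms(1)
proof (induction rule: polys_induct)
  case zero
  then show ?case by (simp add: polys_const)
next
  case (step c xs f)
  have "(\<lambda>x. monomial xs x * g x) \<in> polys (j + k)"
    using assms(2)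
  proof (induction rule: polys_induct)
    case zero
    then show ?case by (simp add: polys_const)
  next
    case (step d ys g)
    have "monomial (xs @ ys) \<in> polys (j + k)"
      using step.hyps(1) \<open>length xs \<le> j\<close> by (intro polys_monomial) simp
    from polys_add[OF polys_cmult[OF this, of d] step.IH] show ?case
      by (simp add: monomial_def algebra_simps)
  qed
  from polys_add[OF polys_cmult[OF this, of c] step.IH] show ?case
    by (simp add: algebra_simps)
qed

lemma polys_nth: "(\<lambda>x. x $ i) \<in> polys 1"
  using polys_monomial[of "[i]" 1] by (simp add: monomial_def[abs_def])

text \<open>Supplies a degree bound for the approximant given by Stone-Weierstrass, and with it the
  finite-dimensional space in which the Dirichlet problem is solved.\<close>

lemma real_polynomial_function_polys:
  fixes f :: "real^'n \<Rightarrow> real"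
  assumes "real_polynomial_function f"
  shows "\<exists>k. f \<in> polys k"
  using assms
proof induction
  case (linear f)
  define a where "a i = f (axis i 1)" for i
  have "f = (\<lambda>x. \<Sum>i\<in>UNIV. a i * x $ i)"
  proof
    fix x
    have "f x = f (\<Sum>i\<in>UNIV. x $ i *\<^sub>R axis i 1)"
      using basis_expansion[of x] by (simp add: scalar_mult_eq_scaleR)
    then show "f x = (\<Sum>i\<in>UNIV. a i * x $ i)"
      using bounded_linear.linear[OF linear]
      by (simp add: linear_sum linear_cmul a_def mult.commute)
  qed
  moreover have "(\<lambda>x. \<Sum>i\<in>UNIV. a i * x $ i) \<in> polys 1"
    by (intro polys_sum polys_cmult polys_nth)
  ultimately have "f \<in> polys 1" by simp
  then show ?case ..
next
  case (const c)
  then show ?case using polys_const by blast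
next
  case (add f g)
  then obtain j k where "f \<in> polys j" "g \<in> polys k" by blast
  then have "f \<in> polys (max j k)" "g \<in> polys (max j k)"
    by (meson max.cobounded1 max.cobounded2 polys_mono subsetD)+
  then show ?case using polys_add by blast
next
  case (mult f g)
  then show ?case using polys_mult by blast
qed

lemma polys_real_polynomial_function:
  assumes "f \<in> polys k"
  shows "real_polynomial_function f"
  using assms
proof (induction rule: polys_induct)
  case zero
  show ?case by (rule real_polynomial_function.intros(2))
next
  case (step c xs g)
  have "real_polynomial_function (monomial xs)"
  proof (induction xs)
    case Nil
    show ?case unfolding monomial_def[abs_def] by (simp add: real_polynomial_function.intros(2))
  next
    case (Cons i xs)
    then show ?case
      using real_polynomial_function.intros(4)[OF real_polynomial_function.intros(1)[OF bounded_linear_vec_nth[of i]]]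
      unfolding monomial_def[abs_def] by simp
  qed
  then show ?case
    using step real_polynomial_function.intros(2,3,4) by blast
qed

text \<open>On the line from \<open>z\<close> through \<open>x\<close> the function is a polynomial
  in one variable that vanishes on an interval, hence has zero coefficients; the value at parameter
  \<open>1\<close> is \<open>f x\<close>.\<close>

lemma polys_eq_0:
  assumes f: "f \<in> polys k" and "r > 0" and z: "\<And>x. x \<in> ball z r \<Longrightarrow> f x = 0"
  shows "f x = 0"
proof -
  have "real_polynomial_function (f \<circ> (\<lambda>t::real. z + t *\<^sub>R (x - z)))"
    by (intro real_polynomial_function_compose polys_real_polynomial_function[OF f]
        polynomial_function_add polynomial_function_const polynomial_function_mult polynomial_function_id)
  then obtain a n where a: "f \<circ> (\<lambda>t. z + t *\<^sub>R (x - z)) = (\<lambda>t. \<Sum>i\<le>n. a i * t ^ i)"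
    using real_polynomial_function_imp_sum by blast
  define m where "m = r / (norm (x - z) + 1)"
  have np: "norm (x - z) + 1 > 0" by (auto intro: add_nonneg_pos)
  have m: "m > 0" using \<open>r > 0\<close> np by (simp add: m_def)
  have "{0<..<m} \<subseteq> {t. (\<Sum>i\<le>n. a i * t ^ i) = 0}"
  proof
    fix t assume t: "t \<in> {0<..<m}"
    have "t * norm (x - z) \<le> t * (norm (x - z) + 1)" using t by simp
    also have "\<dots> < r" using t np by (simp add: m_def field_simps)
    finally have "z + t *\<^sub>R (x - z) \<in> ball z r" using t by (simp add: dist_norm)
    then have "(f \<circ> (\<lambda>t. z + t *\<^sub>R (x - z))) t = 0" using z by simp
    then show "t \<in> {t. (\<Sum>i\<le>n. a i * t ^ i) = 0}" unfolding a by simp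
  qed
  then have "infinite {t. (\<Sum>i\<le>n. a i * t ^ i) = 0}"
    using m infinite_Ioo finite_subset by blast
  then have "\<forall>i\<le>n. a i = 0"
    unfolding polyfun_finite_roots by blast
  then have "(f \<circ> (\<lambda>t. z + t *\<^sub>R (x - z))) 1 = 0" unfolding a by simp
  then show ?thesis by simp
qed

section \<open>Partial derivatives and Hessians of polynomials\<close>

definition pd :: "'n \<Rightarrow> (real^'n \<Rightarrow> real) \<Rightarrow> real^'n \<Rightarrow> real" where
  "pd i f x = frechet_derivative f (at x) (axis i 1)"

text \<open>Row \<open>i\<close> is the gradient of \<open>pd i f\<close>, so that the matrix acts
  as the derivative of the gradient without any appeal to symmetry.\<close>

definition Hess :: "(real^'n \<Rightarrow> real) \<Rightarrow> real^'n \<Rightarrow> real^'n^'n" where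
  "Hess f x = (\<chi> i j. pd j (pd i f) x)"

lemma polys_differentiable: "f \<in> polys k \<Longrightarrow> f differentiable (at x)"
  by (simp add: polys_real_polynomial_function differentiable_at_real_polynomial_function)

lemma pd_eqI: "(f has_derivative f') (at x) \<Longrightarrow> pd i f x = f' (axis i 1)"
  unfolding pd_def using frechet_derivative_at by metis

lemma has_derivative_pd:
  assumes "f differentiable (at x)"
  shows "(f has_derivative (\<lambda>h. (\<chi> i. pd i f x) \<bullet> h)) (at x)"
proof -
  define f' where "f' = frechet_derivative f (at x)"
  have f': "(f has_derivative f') (at x)"
    using assms by (simp add: f'_def frechet_derivative_works)
  have "f' h = (\<chi> i. pd i f x) \<bullet> h" for h
  proof -
    have "f' h = f' (\<Sum>i\<in>UNIV. h $ i *\<^sub>R axis i 1)"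
      using basis_expansion[of h] by (simp add: scalar_mult_eq_scaleR)
    also have "\<dots> = (\<Sum>i\<in>UNIV. h $ i * f' (axis i 1))"
      using has_derivative_linear[OF f'] by (simp add: linear_sum linear_cmul)
    finally show ?thesis
      by (simp add: inner_vec_def pd_def f'_def mult.commute)
  qed
  then have "f' = (\<lambda>h. (\<chi> i. pd i f x) \<bullet> h)" by (rule ext)
  then show ?thesis using f' by simp
qed

lemma pd_add:
  assumes "f \<in> polys j" "g \<in> polys k"
  shows "pd i (\<lambda>x. f x + g x) = (\<lambda>x. pd i f x + pd i g x)"
proof
  show "pd i (\<lambda>x. f x + g x) x = pd i f x + pd i g x" for x
    using pd_eqI[OF has_derivative_add[OF assms[THEN polys_differentiable, THEN has_derivative_pd]]]
    by (simp add: inner_axis)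
qed

lemma pd_cmult:
  assumes "f \<in> polys k"
  shows "pd i (\<lambda>x. c * f x) = (\<lambda>x. c * pd i f x)"
proof
  show "pd i (\<lambda>x. c * f x) x = c * pd i f x" for x
    using pd_eqI[OF has_derivative_mult_right[OF assms[THEN polys_differentiable, THEN has_derivative_pd]]]
    by (simp add: inner_axis)
qed

lemma pd_const: "pd i (\<lambda>x. c) = (\<lambda>x. 0)"
  using pd_eqI[OF has_derivative_const] by auto

lemma pd_monomial:
  "length xs \<le> Suc k \<Longrightarrow> pd i (monomial xs) \<in> polys k"
proof (induction xs arbitrary: k)
  case Nil
  then show ?case by (simp add: monomial_def[abs_def] pd_const polys_const)
next
  case (Cons j xs)
  have eq: "pd i (monomial (j # xs)) = (\<lambda>x. x $ j * pd i (monomial xs) x + (axis i 1) $ j * monomial xs x)"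
  proof
    fix x
    have "(monomial xs has_derivative (\<lambda>h. (\<chi> i. pd i (monomial xs) x) \<bullet> h)) (at x)"
      by (intro has_derivative_pd polys_differentiable[OF polys_monomial[OF order_refl]])
    from has_derivative_mult[OF bounded_linear_imp_has_derivative[OF bounded_linear_vec_nth[of j]] this]
    have "(monomial (j # xs) has_derivative
        (\<lambda>h. x $ j * ((\<chi> i. pd i (monomial xs) x) \<bullet> h) + h $ j * monomial xs x)) (at x)"
      by (simp add: monomial_def[abs_def])
    from pd_eqI[OF this, of i]
    show "pd i (monomial (j # xs)) x = x $ j * pd i (monomial xs) x + (axis i 1) $ j * monomial xs x"
      by (simp add: inner_axis)
  qed
  have "(\<lambda>x. x $ j * pd i (monomial xs) x) \<in> polys k"
  \<comment> \<open>Multiplication by a coordinate raises the degree by one, so the tail must be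
    differentiated within degree \<open>k - 1\<close>. For \<open>k = 0\<close> the tail is empty
    and its derivative vanishes.\<close>
  proof (cases k)
    case 0
    then have "xs = []" using Cons.prems by simp
    then show ?thesis by (simp add: monomial_def[abs_def] pd_const polys_const)
  next
    case (Suc m)
    then have "pd i (monomial xs) \<in> polys m" using Cons by simp
    from polys_mult[OF polys_nth this] show ?thesis by (simp add: Suc)
  qed
  moreover have "(\<lambda>x. (axis i 1) $ j * monomial xs x) \<in> polys k"
    using Cons.prems by (intro polys_cmult polys_monomial) simp
  ultimately show ?case unfolding eq by (rule polys_add)
qed

lemma pd_polys: "f \<in> polys (Suc k) \<Longrightarrow> pd i f \<in> polys k"
proof (induction rule: polys_induct)
  case zero
  then show ?case by (simp add: pd_const polys_const)
next
  case (step c xs g)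
  have "pd i (\<lambda>x. c * monomial xs x + g x) = (\<lambda>x. c * pd i (monomial xs) x + pd i g x)"
    using pd_add[OF polys_cmult[OF polys_monomial[OF step.hyps(1)]] step.hyps(2)]
      pd_cmult[OF polys_monomial[OF step.hyps(1)]] by simp
  then show ?case
    using polys_add[OF polys_cmult[OF pd_monomial[OF step.hyps(1)]] step.IH] by simp
qed

lemma C2_with_polys:
  fixes f :: "real^'n \<Rightarrow> real"
  assumes "f \<in> polys k"
  shows "C2_with f (\<lambda>x. \<chi> i. pd i f x) (Hess f) \<Omega>"
proof -
  \<comment> \<open>Two spare degrees allow differentiating twice without treating degrees below two
    separately.\<close>
  have f: "f \<in> polys (Suc (Suc k))" using assms polys_mono[of k "Suc (Suc k)"] by auto
  have p1: "pd i f \<in> polys (Suc k)" for i using pd_polys[OF f] .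
  have p2: "pd j (pd i f) \<in> polys k" for i j using pd_polys[OF p1] .
  show ?thesis
    unfolding C2_with_def
  proof (intro conjI ballI)
    fix x
    show "(f has_derivative (\<lambda>h. (\<chi> i. pd i f x) \<bullet> h)) (at x)"
      by (intro has_derivative_pd polys_differentiable[OF f])
    have "((\<lambda>x. \<chi> i. pd i f x) has_derivative (\<lambda>h. \<chi> i. (\<chi> j. pd j (pd i f) x) \<bullet> h)) (at x)"
      unfolding has_derivative_componentwise_within[of "\<lambda>x. \<chi> i. pd i f x"]
      using has_derivative_pd[OF polys_differentiable[OF p1]]
      by (auto simp: Basis_vec_def inner_axis)
    also have "(\<lambda>h. \<chi> i. (\<chi> j. pd j (pd i f) x) \<bullet> h) = (\<lambda>h. Hess f x *v h)"
      by (simp add: fun_eq_iff vec_eq_iff Hess_def matrix_vector_mult_def inner_vec_def)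
    finally show "((\<lambda>x. \<chi> i. pd i f x) has_derivative (\<lambda>h. Hess f x *v h)) (at x)" .
  next
    have "continuous_on \<Omega> (pd j (pd i f))" for i j
      using polys_differentiable[OF p2]
      by (meson continuous_at_imp_continuous_on differentiable_imp_continuous_within)
    then show "continuous_on \<Omega> (Hess f)"
      unfolding Hess_def[abs_def] by (intro continuous_on_vec_lambda)
  qed
qed

lemma inner_Hess: "A \<bullet> Hess f x = (\<Sum>i\<in>UNIV. \<Sum>j\<in>UNIV. A $ i $ j * pd j (pd i f) x)"
  by (simp add: inner_vec_def Hess_def)

lemma inner_Hess_polys:
  assumes "f \<in> polys (Suc (Suc k))"
  shows "(\<lambda>x. A \<bullet> Hess f x) \<in> polys k"
  unfolding inner_Hess by (intro polys_sum polys_cmult pd_polys assms)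

lemma Hess_lincomb:
  assumes f: "f \<in> polys k" and g: "g \<in> polys k"
  shows "Hess (\<lambda>x. a * f x + b * g x) x = a *\<^sub>R Hess f x + b *\<^sub>R Hess g x"
proof -
  have f: "f \<in> polys (Suc k)" and g: "g \<in> polys (Suc k)"
    using f g polys_mono[of k "Suc k"] by auto
  have "pd i (\<lambda>x. a * f x + b * g x) = (\<lambda>x. a * pd i f x + b * pd i g x)" for i
    using pd_add[OF polys_cmult[OF f] polys_cmult[OF g]] by (simp add: pd_cmult[OF f] pd_cmult[OF g])
  moreover have "pd j (\<lambda>x. a * pd i f x + b * pd i g x) = (\<lambda>x. a * pd j (pd i f) x + b * pd j (pd i g) x)" for i j
    using pd_add[OF polys_cmult[OF pd_polys[OF f]] polys_cmult[OF pd_polys[OF g]]]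
    by (simp add: pd_cmult[OF pd_polys[OF f]] pd_cmult[OF pd_polys[OF g]])
  ultimately show ?thesis
    by (simp add: Hess_def vec_eq_iff)
qed

section \<open>The Dirichlet problem on a ball for polynomial data\<close>

lemma polys_sphere_defining: "(\<lambda>x. r\<^sup>2 - (x - z) \<bullet> (x - z)) \<in> polys 2"
proof -
  have "(\<lambda>x. (x $ i - z $ i) * (x $ i - z $ i)) \<in> polys (1 + 1)" for i
    by (intro polys_mult polys_diff polys_nth polys_const)
  then have "(\<lambda>x. r\<^sup>2 - (\<Sum>i\<in>UNIV. (x $ i - z $ i) * (x $ i - z $ i))) \<in> polys (1 + 1)"
    by (intro polys_diff polys_const polys_sum)
  then show ?thesis by (simp add: inner_vec_def numeral_2_eq_2)
qed

text \<open>The product of \<open>q\<close> with the defining function of the sphere solves the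
  homogeneous equation and vanishes on the sphere. Comparison with zero makes it nonpositive inside,
  where the first factor is positive.\<close>

lemma polys_max_principle:
  assumes A: "elliptic_mat A" and "r > 0" and q: "q \<in> polys k"
    and L: "\<And>x. A \<bullet> Hess (\<lambda>x. (r\<^sup>2 - (x - z) \<bullet> (x - z)) * q x) x = 0"
    and x: "x \<in> ball z r"
  shows "q x \<le> 0"
proof -
  define f where "f = (\<lambda>x. (r\<^sup>2 - (x - z) \<bullet> (x - z)) * q x)"
  have f: "f \<in> polys (2 + k)" unfolding f_def by (intro polys_mult polys_sphere_defining q)
  have "visc_subsol (\<lambda>M. A \<bullet> M - 0) f UNIV"
    using visc_subsol_classical[OF A open_UNIV C2_with_polys[OF f], of 0] L by (simp add: f_def)
  then have "f x \<le> 0"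
  proof (rule visc_subsol_comparison[OF A, where z = z and r = r])
    show "C2_with (\<lambda>x. 0) (\<lambda>x. 0) (\<lambda>x. 0) (UNIV :: (real^'a) set)"
      by (simp add: C2_with_def)
    show "x \<in> cball z r" using x by simp
    fix y assume "y \<in> sphere z r"
    then have "(y - z) \<bullet> (y - z) = r\<^sup>2"
      by (auto simp: dist_norm norm_minus_commute power2_norm_eq_inner[symmetric])
    then show "f y \<le> 0" by (simp add: f_def)
  qed auto
  moreover have "(x - z) \<bullet> (x - z) < r\<^sup>2"
    using x by (simp add: dist_norm norm_minus_commute power2_norm_eq_inner[symmetric] power_strict_mono)
  ultimately show ?thesis by (simp add: f_def mult_le_0_iff)
qed

text \<open>With the ansatz \<open>h = p - b q\<close> the boundary values are right for every
  \<open>q\<close>, and the equation becomes \<open>T q = A \<bullet> D^2 p - c\<close>.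
  Multiplication by \<open>b\<close> adds two degrees and the Hessian removes two, so
  \<open>T\<close> maps \<open>polys k\<close> to itself, and injectivity suffices for
  solvability.\<close>

lemma polys_dirichlet:
  assumes A: "elliptic_mat A" and r: "r > 0" and p: "p \<in> polys k"
  obtains h where "h \<in> polys (Suc (Suc k))" "\<And>x. A \<bullet> Hess h x = c" "\<And>x. x \<in> sphere z r \<Longrightarrow> h x = p x"
proof -
  define b where "b = (\<lambda>x. r\<^sup>2 - (x - z) \<bullet> (x - z))"
  define T where "T q = (\<lambda>x. A \<bullet> Hess (\<lambda>x. b x * q x) x)" for q
  have bq: "(\<lambda>x. b x * q x) \<in> polys (Suc (Suc k))" if "q \<in> polys k" for q
    using polys_mult[OF polys_sphere_defining that] by (simp add: b_def)
  have p: "p \<in> polys (Suc (Suc k))" using p polys_mono[of k "Suc (Suc k)"] by auto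
  have lin: "T (\<lambda>x. s * q x + t * q' x) = (\<lambda>x. s * T q x + t * T q' x)"
    if "q \<in> polys k" "q' \<in> polys k" for q q' s t
    using Hess_lincomb[OF bq[OF that(1)] bq[OF that(2)], of s t]
    by (simp add: T_def algebra_simps inner_add_right)
  have g: "(\<lambda>x. A \<bullet> Hess p x - c) \<in> polys k"
    by (intro polys_diff polys_const inner_Hess_polys p)
  obtain q where q: "q \<in> polys k" "T q = (\<lambda>x. A \<bullet> Hess p x - c)"
  proof (rule fun_vs.injective_on_span_imp_surjective[OF finite_monomials[of k], folded polys_def, of T])
    show "T f \<in> polys k" if "f \<in> polys k" for f
      unfolding T_def by (intro inner_Hess_polys bq that)
    show "T (f + g) = T f + T g" if "f \<in> polys k" "g \<in> polys k" for f g
      using lin[OF that, of 1 1] by (simp add: plus_fun_def)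
    show "T (\<lambda>x. a * f x) = (\<lambda>x. a * T f x)" if "f \<in> polys k" for f a
      using lin[OF that that, of a 0] by simp
    \<comment> \<open>The maximum principle for both \<open>f\<close> and its negative gives zero on
      the ball, and a polynomial vanishing on a ball vanishes everywhere.\<close>
    show "f = 0" if f: "f \<in> polys k" and "T f = 0" for f
    proof -
      have "T (\<lambda>x. -1 * f x) = (\<lambda>x. -1 * T f x)" using lin[OF f f, of "-1" 0] by simp
      then have "f x \<le> 0" "-1 * f x \<le> 0" if "x \<in> ball z r" for x
        using polys_max_principle[OF A r f, of z, OF _ that]
          polys_max_principle[OF A r polys_cmult[OF f, of "-1"], of z, OF _ that] \<open>T f = 0\<close>
        by (simp_all add: T_def b_def fun_eq_iff)
      then have "f x = 0" for x
        using polys_eq_0[OF f r, of z] by force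
      then show ?thesis by (simp add: fun_eq_iff)
    qed
  qed (use g that in auto)
  define h where "h = (\<lambda>x. 1 * p x + (-1) * (b x * q x))"
  show ?thesis
  proof (rule that[of h])
    show "h \<in> polys (Suc (Suc k))"
      unfolding h_def by (intro polys_add polys_cmult bq p q)
    show "A \<bullet> Hess h x = c" for x
      unfolding h_def Hess_lincomb[OF p bq[OF q(1)]] using fun_cong[OF q(2), of x]
      by (simp add: T_def inner_add_right inner_diff_right)
    show "h x = p x" if "x \<in> sphere z r" for x
    proof -
      have "(x - z) \<bullet> (x - z) = r\<^sup>2"
        using that by (auto simp: dist_norm norm_minus_commute power2_norm_eq_inner[symmetric])
      then show ?thesis by (simp add: h_def b_def)
    qed
  qed
qed

section \<open>Convex combinations of subsolutions\<close>

text \<open>Two nonsmooth functions cannot be tested at once, so \<open>v\<close> is exchanged for a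
  polynomial solution \<open>h\<close> lying above it on a small ball and close to it on the sphere.
  Moving \<open>h\<close> into the test function leaves only \<open>u\<close> to be tested.\<close>

lemma visc_subsol_linear_lincomb:
  fixes u v :: "real^'n \<Rightarrow> real"
  assumes A: "elliptic_mat A" and \<Omega>: "open \<Omega>"
    and u: "visc_subsol (\<lambda>M. A \<bullet> M - c) u \<Omega>" and v: "visc_subsol (\<lambda>M. A \<bullet> M - c) v \<Omega>"
    and \<theta>: "0 < \<theta>" "\<theta> < 1"
  shows "visc_subsol (\<lambda>M. A \<bullet> M - c) (\<lambda>x. \<theta> * u x + (1 - \<theta>) * v x) \<Omega>"
  unfolding visc_subsol_def
proof (intro conjI allI impI)
  have cu: "continuous_on \<Omega> u" and cv: "continuous_on \<Omega> v"
    using u v by (auto simp: visc_subsol_def)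
  then show "continuous_on \<Omega> (\<lambda>x. \<theta> * u x + (1 - \<theta>) * v x)"
    by (intro continuous_intros)
  fix \<phi> :: "real^'n \<Rightarrow> real" and D H x0
  assume \<phi>: "C2_with \<phi> D H \<Omega>" and x0: "x0 \<in> \<Omega>"
    and max: "local_max_on (\<lambda>x. \<theta> * u x + (1 - \<theta>) * v x - \<phi> x) \<Omega> x0"
  show "0 \<le> A \<bullet> H x0 - c"
  proof (rule ccontr)
    assume "\<not> 0 \<le> A \<bullet> H x0 - c"
    then have less: "A \<bullet> H x0 < c" by simp
    define m where "m = A \<bullet> mat 1"
    have m: "m > 0" unfolding m_def by (rule elliptic_mat_1[OF A])
    \<comment> \<open>Adding \<open>\<eta>\<close> |x - x0|^2 raises the operator by
      \<open>\<eta> * (2 * m)\<close>, half of the gap, so the strict inequality survives while the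
      maximum at \<open>x0\<close> becomes strict.\<close>
    define \<eta> where "\<eta> = (c - A \<bullet> H x0) / (4 * m)"
    have \<eta>: "\<eta> > 0" using less m by (simp add: \<eta>_def)
    have \<eta>m: "\<eta> * (2 * m) = (c - A \<bullet> H x0) / 2" using m by (simp add: \<eta>_def)
    define \<psi> where "\<psi> = (\<lambda>x. 1 * \<phi> x + \<eta> * ((x - x0) \<bullet> (x - x0)))"
    define G where "G = (\<lambda>x. 1 *\<^sub>R H x + \<eta> *\<^sub>R 2 *\<^sub>R mat 1)"
    obtain E where \<psi>: "C2_with \<psi> E G \<Omega>"
      using C2_with_lincomb[OF \<phi> C2_with_square_norm[of x0], of 1 \<eta>] unfolding \<psi>_def G_def by blast
    have "continuous_on \<Omega> (\<lambda>x. A \<bullet> G x)"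
      using \<psi> unfolding C2_with_def by (intro continuous_intros) auto
    then have "open (\<Omega> \<inter> (\<lambda>x. A \<bullet> G x) -` {..<c})"
      using \<Omega> by (rule continuous_open_preimage) simp
    moreover have "A \<bullet> G x0 < c"
      using \<eta>m less by (simp add: G_def inner_add_right m_def)
    moreover obtain e where e: "e > 0" "\<And>y. y \<in> \<Omega> \<inter> ball x0 e \<Longrightarrow>
        \<theta> * u y + (1 - \<theta>) * v y - \<phi> y \<le> \<theta> * u x0 + (1 - \<theta>) * v x0 - \<phi> x0"
      using max unfolding local_max_on_def by blast
    ultimately have "open (\<Omega> \<inter> (\<lambda>x. A \<bullet> G x) -` {..<c} \<inter> ball x0 e)"
      "x0 \<in> \<Omega> \<inter> (\<lambda>x. A \<bullet> G x) -` {..<c} \<inter> ball x0 e"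
      using x0 by auto
    then obtain r where r: "r > 0" "cball x0 r \<subseteq> \<Omega> \<inter> (\<lambda>x. A \<bullet> G x) -` {..<c} \<inter> ball x0 e"
      using open_contains_cball by metis
    have r\<Omega>: "cball x0 r \<subseteq> \<Omega>" and rG: "\<And>x. x \<in> cball x0 r \<Longrightarrow> A \<bullet> G x < c"
      and re: "\<And>x. x \<in> cball x0 r \<Longrightarrow> x \<in> \<Omega> \<inter> ball x0 e"
      using r(2) by auto
    \<comment> \<open>On the sphere \<open>\<psi>\<close> exceeds \<open>\<phi>\<close> by
      \<open>4 * \<delta>\<close>, whereas \<open>h\<close> exceeds \<open>v\<close> by at most
      \<open>2 * \<delta>\<close>; the remaining \<open>2 * \<delta>\<close> keeps the maximum off
      the sphere.\<close>
    define \<delta> where "\<delta> = \<eta> * r\<^sup>2 / 4"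
    have \<delta>: "\<delta> > 0" using \<eta> r by (simp add: \<delta>_def)
    have "continuous_on (sphere x0 r) v"
      using cv r\<Omega> by (meson continuous_on_subset sphere_cball subset_trans)
    then obtain p0 where p0: "real_polynomial_function p0" "\<And>x. x \<in> sphere x0 r \<Longrightarrow> \<bar>v x - p0 x\<bar> < \<delta>"
      using Stone_Weierstrass_real_polynomial_function[OF compact_sphere _ \<delta>] by blast
    obtain k where "p0 \<in> polys k" using real_polynomial_function_polys[OF p0(1)] by blast
    \<comment> \<open>The shift by \<open>\<delta>\<close> places the boundary data above
      \<open>v\<close>, at distance at most \<open>2 * \<delta>\<close>.\<close>
    then have "(\<lambda>x. p0 x + \<delta>) \<in> polys k" by (intro polys_add polys_const)
    then obtain h where h: "h \<in> polys (Suc (Suc k))" "\<And>x. A \<bullet> Hess h x = c"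
      and hs: "\<And>x. x \<in> sphere x0 r \<Longrightarrow> h x = p0 x + \<delta>"
      by (rule polys_dirichlet[OF A r(1), where c = c and z = x0]) blast
    have hv: "v x \<le> h x" "h x \<le> v x + 2 * \<delta>" if "x \<in> sphere x0 r" for x
      using hs[OF that] p0(2)[OF that] by auto
    have vh: "v x \<le> h x" if "x \<in> cball x0 r" for x
      by (rule visc_subsol_comparison[OF A v r\<Omega> C2_with_polys[OF h(1)] _ hv(1) that]) (simp add: h(2))
    define f where "f = (\<lambda>x. \<theta> * u x + (1 - \<theta>) * h x - \<psi> x)"
    have "continuous_on \<Omega> f"
      unfolding f_def
      by (intro continuous_intros cu C2_with_continuous_on[OF C2_with_polys[OF h(1)]] C2_with_continuous_on[OF \<psi>])
    then have "continuous_on (cball x0 r) f" using r\<Omega> by (rule continuous_on_subset)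
    then obtain y where y: "y \<in> cball x0 r" "\<And>x. x \<in> cball x0 r \<Longrightarrow> f x \<le> f y"
      using continuous_attains_sup[OF compact_cball, of x0 r f] r(1) by auto
    have "y \<in> ball x0 r"
    proof (rule ccontr)
      assume "y \<notin> ball x0 r"
      then have ys: "y \<in> sphere x0 r" using y(1) by auto
      then have "(y - x0) \<bullet> (y - x0) = r\<^sup>2"
        by (auto simp: dist_norm norm_minus_commute power2_norm_eq_inner[symmetric])
      then have \<psi>y: "\<psi> y = \<phi> y + 4 * \<delta>" by (simp add: \<psi>_def \<delta>_def)
      have "(1 - \<theta>) * h y \<le> (1 - \<theta>) * (v y + 2 * \<delta>)"
        using hv(2)[OF ys] \<theta> by (intro mult_left_mono) auto
      also have "\<dots> \<le> (1 - \<theta>) * v y + 2 * \<delta>" using \<theta> \<delta> by (simp add: algebra_simps)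
      finally have "f y \<le> \<theta> * u y + (1 - \<theta>) * v y - \<phi> y - 2 * \<delta>"
        unfolding f_def \<psi>y by simp
      also have "\<dots> < \<theta> * u x0 + (1 - \<theta>) * v x0 - \<phi> x0"
        using e(2)[OF re[OF y(1)]] \<delta> by simp
      also have "\<dots> \<le> f x0"
        using vh[of x0] r(1) \<theta> by (simp add: f_def \<psi>_def)
      finally show False using y(2)[of x0] r(1) by simp
    qed
    \<comment> \<open>Solving \<open>f\<close> for \<open>u\<close>: the test function is (\<psi> -
      (1 - \<theta>) h) / \<theta>. As \<open>h\<close> solves the equation exactly, the inequality
      for \<open>u\<close> becomes \<open>c \<le> A \<bullet> G y\<close>, against the choice of the
      ball.\<close>
    then have "local_max_on (\<lambda>x. u x - ((1 / \<theta>) * \<psi> x + (- (1 - \<theta>) / \<theta>) * h x)) \<Omega> y"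
    proof (rule local_max_on_ball)
      fix x assume "x \<in> cball x0 r"
      have "u x - ((1 / \<theta>) * \<psi> x + (- (1 - \<theta>) / \<theta>) * h x) = f x / \<theta>" for x
        using \<theta> by (simp add: f_def field_simps)
      then show "u x - ((1 / \<theta>) * \<psi> x + (- (1 - \<theta>) / \<theta>) * h x) \<le>
          u y - ((1 / \<theta>) * \<psi> y + (- (1 - \<theta>) / \<theta>) * h y)"
        using y(2)[OF \<open>x \<in> cball x0 r\<close>] \<theta> by (simp add: divide_right_mono)
    qed
    then have "0 \<le> A \<bullet> ((1 / \<theta>) *\<^sub>R G y + (- (1 - \<theta>) / \<theta>) *\<^sub>R Hess h y) - c"
      using visc_subsolD[OF u C2_with_lincomb[OF \<psi> C2_with_polys[OF h(1)], of "1 / \<theta>" "- (1 - \<theta>) / \<theta>"]]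
        y(1) r\<Omega> by blast
    then have "0 \<le> (1 / \<theta>) * (A \<bullet> G y) + (- (1 - \<theta>) / \<theta>) * c - c"
      by (simp only: inner_add_right inner_scaleR_right h(2))
    then have "c \<le> A \<bullet> G y" using \<theta> by (simp add: field_simps)
    then show False using rG[OF y(1)] by simp
  qed
qed

section \<open>Separation from the superlevel set and reduction to linear equations\<close>

lemma mat_norm_pos:
  fixes N :: "real^'n^'n"
  assumes "N \<noteq> 0" shows "0 < mat_norm N"
proof -
  have "\<exists>x. N *v x \<noteq> 0" using assms matrix_eq[of N 0] by auto
  then show ?thesis
    unfolding mat_norm_def using onorm_pos_lt[OF matrix_vector_mul_bounded_linear] by blast
qed

text \<open>Quasiconcavity and continuity make the superlevel set convex and closed, so
  \<open>M\<close> can be strictly separated from it. By ellipticity each ray from \<open>M\<close>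
  in a nonzero positive semidefinite direction \<open>N\<close> enters the set, so
  \<open>A \<bullet> N\<close> must be positive.\<close>

lemma superlevel_separation:
  fixes F :: "real^'n^'n \<Rightarrow> real"
  assumes ell: "unif_elliptic F lam Lam" and cont: "continuous_on {M. sym_mat M} F"
    and quasi: "quasiconcave F" and M: "sym_mat M" "F M < 0"
  obtains A c where "elliptic_mat A" "A \<bullet> M < c" "\<And>N. sym_mat N \<Longrightarrow> 0 \<le> F N \<Longrightarrow> c \<le> A \<bullet> N"
proof -
  define K where "K = {N. sym_mat N \<and> 0 \<le> F N}"
  have "closed {N :: real^'n^'n. sym_mat N}"
  proof -
    have "closed {N :: real^'n^'n. \<forall>i j. N $ j $ i = N $ i $ j}"
      by (intro closed_Collect_all closed_Collect_eq continuous_intros)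
    then show ?thesis by (simp add: sym_mat_def transpose_def vec_eq_iff)
  qed
  then have "closed ({N. sym_mat N} \<inter> F -` {0..})"
    using cont by (intro continuous_closed_preimage) auto
  then have clK: "closed K" by (simp add: K_def Collect_conj_eq vimage_def)
  have cvK: "convex K"
    unfolding convex_alt
  proof (intro ballI allI impI)
    fix X Y t assume *: "X \<in> K" "Y \<in> K" "0 \<le> t \<and> t \<le> (1::real)"
    then have "sym_mat ((1 - t) *\<^sub>R X + t *\<^sub>R Y)"
      by (simp add: K_def sym_mat_def transpose_def vec_eq_iff)
    moreover have "0 \<le> F ((1 - t) *\<^sub>R X + t *\<^sub>R Y)"
      using quasi * unfolding quasiconcave_def K_def
      by (metis (no_types, lifting) add.commute mem_Collect_eq min_def order_trans)
    ultimately show "(1 - t) *\<^sub>R X + t *\<^sub>R Y \<in> K" by (simp add: K_def)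
  qed
  obtain A c where Ac: "A \<bullet> M < c" "\<And>N. N \<in> K \<Longrightarrow> c < A \<bullet> N"
    using separating_hyperplane_closed_point[OF cvK clK, of M] M(2) by (auto simp: K_def)
  have "0 < A \<bullet> N" if N: "sym_mat N" "psd_mat N" "N \<noteq> 0" for N
  proof -
    have lam: "0 < lam" using ell by (simp add: unif_elliptic_def)
    have nN: "0 < mat_norm N" using mat_norm_pos[OF N(3)] .
    \<comment> \<open>With this length the lower ellipticity bound
      \<open>lam * mat_norm (t *\<^sub>R N)\<close> equals \<open>- F M\<close>, just enough to
      reach \<open>F \<ge> 0\<close>.\<close>
    define t where "t = - F M / (lam * mat_norm N)"
    have t: "0 < t" unfolding t_def using M(2) lam nN by (intro divide_pos_pos mult_pos_pos) auto
    have tN: "sym_mat (t *\<^sub>R N)" "psd_mat (t *\<^sub>R N)"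
      using N t by (auto simp: sym_mat_def psd_mat_def transpose_def vec_eq_iff scaleR_matrix_vector_assoc[symmetric])
    have "mat_norm (t *\<^sub>R N) = t * mat_norm N"
      unfolding mat_norm_def using onorm_scaleR[OF matrix_vector_mul_bounded_linear, of t N] t
      by (simp add: scaleR_matrix_vector_assoc)
    then have "lam * (t * mat_norm N) \<le> F (M + t *\<^sub>R N) - F M"
      using ell M(1) tN unfolding unif_elliptic_def by metis
    moreover have "lam * (t * mat_norm N) = - F M" using lam nN by (simp add: t_def)
    moreover have "sym_mat (M + t *\<^sub>R N)"
      using M(1) tN(1) by (simp add: sym_mat_def transpose_def vec_eq_iff)
    ultimately have "M + t *\<^sub>R N \<in> K" by (simp add: K_def)
    from Ac(2)[OF this] Ac(1) have "0 < t * (A \<bullet> N)" by (simp add: inner_add_right)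
    then show ?thesis using t by (simp add: zero_less_mult_iff)
  qed
  then have "elliptic_mat A" by (simp add: elliptic_mat_def)
  then show ?thesis using that Ac by (force simp: K_def)
qed

lemma visc_subsol_halfspace:
  fixes \<Omega> :: "(real^'n) set"
  assumes "visc_subsol F u \<Omega>" and \<Omega>: "open \<Omega>"
    and "\<And>N. sym_mat N \<Longrightarrow> 0 \<le> F N \<Longrightarrow> c \<le> A \<bullet> N"
  shows "visc_subsol (\<lambda>M. A \<bullet> M - c) u \<Omega>"
  using assms C2_with_sym[OF _ \<Omega>] unfolding visc_subsol_def by fastforce

theorem theorem4p6:
  fixes F :: "real^'n^'n \<Rightarrow> real" and lam Lam :: real
    and u v :: "real^'n \<Rightarrow> real" and \<theta> :: real
  assumes "unif_elliptic F lam Lam"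
    and "continuous_on {M. sym_mat M} F"
    and "quasiconcave F"
    and "visc_subsol F u (ball 0 1)"
    and "visc_subsol F v (ball 0 1)"
    and "0 < \<theta>" and "\<theta> < 1"
  shows "visc_subsol F (\<lambda>x. \<theta> * u x + (1 - \<theta>) * v x) (ball 0 1)"
  unfolding visc_subsol_def
proof (intro conjI allI impI)
  show "continuous_on (ball 0 1) (\<lambda>x. \<theta> * u x + (1 - \<theta>) * v x)"
    using assms(4,5) unfolding visc_subsol_def by (intro continuous_intros) auto
next
  fix \<phi> :: "real^'n \<Rightarrow> real" and D H x0
  assume \<phi>: "C2_with \<phi> D H (ball 0 1)" and x0: "x0 \<in> ball 0 1"
    and max: "local_max_on (\<lambda>x. \<theta> * u x + (1 - \<theta>) * v x - \<phi> x) (ball 0 1) x0"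
  show "0 \<le> F (H x0)"
  proof (rule ccontr)
    assume "\<not> 0 \<le> F (H x0)"
    then have "F (H x0) < 0" by simp
    then obtain A c where A: "elliptic_mat A" "A \<bullet> H x0 < c"
      and K: "\<And>N. sym_mat N \<Longrightarrow> 0 \<le> F N \<Longrightarrow> c \<le> A \<bullet> N"
      using superlevel_separation[OF assms(1-3) C2_with_sym[OF \<phi> open_ball x0]] by blast
    \<comment> \<open>The half-space was built from the single matrix \<open>H x0\<close>, so the
      original \<phi> is the test function that contradicts
      \<open>A \<bullet> H x0 < c\<close>.\<close>
    have "visc_subsol (\<lambda>M. A \<bullet> M - c) (\<lambda>x. \<theta> * u x + (1 - \<theta>) * v x) (ball 0 1)"
      using visc_subsol_halfspace[OF assms(4) open_ball K] visc_subsol_halfspace[OF assms(5) open_ball K]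
      by (intro visc_subsol_linear_lincomb[OF A(1)] open_ball assms(6,7))
    from visc_subsolD[OF this \<phi> x0 max] A(2) show False by simp
  qed
qed

end
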